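(* Let $G=(V,E)$ be a graph, let $F=\{u_1v_1,\dots,u_tv_t\}\subseteq E$, and let $G'=(V',E')$ be a triangular elimination of $G$ with respect to $F$, with node $w_i$ associated with edge $u_iv_i$. Let $\bm{a}\in\mathbb{R}^E$, $a_0\in\mathbb{R}$, $\bm{a}'\in\mathbb{R}^{E'}$, $a'_0\in\mathbb{R}$, and suppose $(\bm{a}')^{\mathrm{T}}\bm{x}\le a'_0$ is a triangular elimination of $\bm{a}^{\mathrm{T}}\bm{x}\le a_0$. Then $(\bm{a}')^{\mathrm{T}}\bm{x}\le a'_0$ is valid for $\mathrm{CUT}^\square(G')$ if and only if $\bm{a}^{\mathrm{T}}\bm{x}\le a_0$ is valid for $\mathrm{CUT}^\square(G)$.
   Context: For a graph $G=(V,E)$ and $S\subseteq V$, the cut vector $\bm{\delta}_G(S)\in\mathbb{R}^E$ has $uv$-coordinate $1$ if $|S\cap\{u,v\}|=1$ and $0$ otherwise. The cut polytope $\mathrm{CUT}^\square(G)$ is the convex hull of all cut vectors $\bm{\delta}_G(S)$, $S\subseteq V$. An inequality is valid for a polytope if every point of the polytope satisfies it. Coordinates are indexed by unordered pairs, $x_{uv}=x_{vu}$. For nodes $u,v,w$ define the triangular forms $\Delta(u,v;w)=x_{uv}-x_{uw}-x_{vw}$ and $\Delta(u,v,w)=x_{uv}+x_{uw}+x_{vw}-2$; $\Delta\{u,v,w\}$ denotes any one of $\Delta(u,v;w)$, $\Delta(w,v;u)$, $\Delta(u,w;v)$, $\Delta(u,v,w)$. Given a graph $G=(V,E)$ and $F=\{u_iv_i\mid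 i=1,\dots,t\}\subseteq E$, a graph $G'=(V',E')$ is a triangular elimination of $G$ with respect to $F$ if $V'=V\cup\{w_1,\dots,w_t\}$ with $w_1,\dots,w_t$ distinct nodes not in $V$, $E'\supseteq\{w_iu_i,w_iv_i\mid i=1,\dots,t\}$, and $E'\cap E=E\setminus F$; node $w_i$ is said to be associated with edge $u_iv_i$. In this situation, $(\bm{a}')^{\mathrm{T}}\bm{x}\le a'_0$ (with $\bm a'\in\mathbb{R}^{E'}$) is a triangular elimination of $\bm{a}^{\mathrm{T}}\bm{x}\le a_0$ (with $\bm a\in\mathbb{R}^E$) if for some choices of triangular forms $\Delta_i\{u_i,v_i,w_i\}$, $i=1,\dots,t$, one has the identity of affine functions $(\bm{a}')^{\mathrm{T}}\bm{x}-a'_0=\bm{a}^{\mathrm{T}}\bm{x}-a_0+\sum_{i=1}^t|a_{u_iv_i}|\,\Delta_i\{u_i,v_i,w_i\}$. *)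

theory Defs
  imports "HOL-Analysis.Analysis" "HOL-Library.Function_Algebras"
begin

text \<open>
  Coordinates are indexed by edges, an edge \<open>uv\<close> being the two-element set \<open>{u, v}\<close>, so that
  \<open>x\<^sub>u\<^sub>v = x\<^sub>v\<^sub>u\<close> holds by construction. A vector of \<open>\<real>\<^sup>E\<close> is a function \<open>'v set \<Rightarrow> real\<close> of which only
  the values on \<open>E\<close> matter. The pointwise vector space structure on functions, which the
  libraries provide only as far as addition, makes \<open>convex hull\<close> available for such vectors.
\<close>

instantiation "fun" :: (type, real_vector) real_vector
begin

definition scaleR_fun :: "real \<Rightarrow> ('a \<Rightarrow> 'b) \<Rightarrow> 'a \<Rightarrow> 'b" where
  "scaleR_fun c f = (\<lambda>i. c *\<^sub>R f i)"

instance
  by standard (auto simp: fun_eq_iff scaleR_fun_def scaleR_add_right scaleR_add_left)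

end

definition simple_graph :: "'v set \<Rightarrow> 'v set set \<Rightarrow> bool" where
  "simple_graph V E \<longleftrightarrow> finite V \<and> (\<forall>e\<in>E. e \<subseteq> V \<and> card e = 2)"

text \<open>Cut vectors vanish outside \<open>E\<close>, which embeds \<open>\<real>\<^sup>E\<close> into the full function space.\<close>

definition cut_vector :: "'v set set \<Rightarrow> 'v set \<Rightarrow> 'v set \<Rightarrow> real" where
  "cut_vector E S = (\<lambda>e. if e \<in> E \<and> card (S \<inter> e) = 1 then 1 else 0)"

definition cut_polytope :: "'v set \<Rightarrow> 'v set set \<Rightarrow> ('v set \<Rightarrow> real) set" where
  "cut_polytope V E = convex hull {cut_vector E S | S. S \<subseteq> V}"

definition edge_inner :: "'v set set \<Rightarrow> ('v set \<Rightarrow> real) \<Rightarrow> ('v set \<Rightarrow> real) \<Rightarrow> real" where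
  "edge_inner E a x = (\<Sum>e\<in>E. a e * x e)"

definition valid_inequality ::
  "'v set set \<Rightarrow> ('v set \<Rightarrow> real) \<Rightarrow> real \<Rightarrow> ('v set \<Rightarrow> real) set \<Rightarrow> bool" where
  "valid_inequality E a a0 P \<longleftrightarrow> (\<forall>x\<in>P. edge_inner E a x \<le> a0)"

text \<open>The forms \<open>\<Delta>(u,v;w)\<close> and \<open>\<Delta>(u,v,w)\<close>, respectively.\<close>

definition tri_homogeneous :: "'v \<Rightarrow> 'v \<Rightarrow> 'v \<Rightarrow> ('v set \<Rightarrow> real) \<Rightarrow> real" where
  "tri_homogeneous u v w x = x {u, v} - x {u, w} - x {v, w}"

definition tri_inhomogeneous :: "'v \<Rightarrow> 'v \<Rightarrow> 'v \<Rightarrow> ('v set \<Rightarrow> real) \<Rightarrow> real" where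
  "tri_inhomogeneous u v w x = x {u, v} + x {u, w} + x {v, w} - 2"

definition triangular_forms :: "'v \<Rightarrow> 'v \<Rightarrow> 'v \<Rightarrow> (('v set \<Rightarrow> real) \<Rightarrow> real) set" where
  "triangular_forms u v w =
    {tri_homogeneous u v w, tri_homogeneous w v u, tri_homogeneous u w v, tri_inhomogeneous u v w}"

text \<open>
  The edges \<open>u\<^sub>1v\<^sub>1, \<dots>, u\<^sub>tv\<^sub>t\<close> are the elements of \<open>F\<close>, without repetition, and serve as their own
  indices: the node associated with \<open>e \<in> F\<close> is \<open>w e\<close>.
\<close>

definition triangular_elimination_graph ::
  "'v set \<Rightarrow> 'v set set \<Rightarrow> 'v set set \<Rightarrow> ('v set \<Rightarrow> 'v) \<Rightarrow> 'v set \<Rightarrow> 'v set set \<Rightarrow> bool" where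
  "triangular_elimination_graph V E F w V' E' \<longleftrightarrow>
     V' = V \<union> w ` F \<and> inj_on w F \<and> w ` F \<inter> V = {} \<and>
     (\<forall>u v. {u, v} \<in> F \<longrightarrow> {w {u, v}, u} \<in> E' \<and> {w {u, v}, v} \<in> E') \<and>
     E' \<inter> E = E - F"

text \<open>
  \<open>D e\<close> is the triangular form chosen for \<open>e\<close>. The identity of affine functions is required on the
  whole function space; every coordinate that occurs in it belongs to \<open>E \<union> E'\<close>.
\<close>

definition triangular_elimination_inequality ::
  "'v set set \<Rightarrow> 'v set set \<Rightarrow> ('v set \<Rightarrow> 'v) \<Rightarrow> 'v set set \<Rightarrow>
    ('v set \<Rightarrow> real) \<Rightarrow> real \<Rightarrow> ('v set \<Rightarrow> real) \<Rightarrow> real \<Rightarrow> bool" where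
  "triangular_elimination_inequality E F w E' a a0 a' a0' \<longleftrightarrow>
     (\<exists>D. (\<forall>u v. {u, v} \<in> F \<longrightarrow> D {u, v} \<in> triangular_forms u v (w {u, v})) \<and>
          (\<forall>x. edge_inner E' a' x - a0' = edge_inner E a x - a0 + (\<Sum>e\<in>F. \<bar>a e\<bar> * D e x)))"

end

theory Submission
  imports Defs
begin

text \<open>
  Validity only has to be tested on cuts. Evaluate the defining identity at a cut vector of the
  complete graph. Every triangular form is nonpositive there, so validity passes from \<open>G\<close> to \<open>G'\<close>.
  Conversely, whatever form was chosen for an edge \<open>uv\<close>, its new node can be placed on a side of
  the cut that makes the form vanish. The new nodes being distinct and outside \<open>V\<close>, this can be
  done for all edges of \<open>F\<close> at once, so every cut of \<open>G\<close> extends to a cut of \<open>G'\<close> with the same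
  slack.
\<close>

lemma convex_edge_inner_le: "convex {x. edge_inner E a x \<le> a0}"
proof (rule convexI)
  fix x y and p q :: real
  assume xy: "x \<in> {x. edge_inner E a x \<le> a0}" "y \<in> {x. edge_inner E a x \<le> a0}"
    and pq: "0 \<le> p" "0 \<le> q" "p + q = 1"
  have "edge_inner E a (p *\<^sub>R x + q *\<^sub>R y) = p * edge_inner E a x + q * edge_inner E a y"
    by (simp add: edge_inner_def scaleR_fun_def sum_distrib_left sum.distrib algebra_simps)
  also have "\<dots> \<le> a0"
    using xy pq by (intro convex_bound_le) auto
  finally show "p *\<^sub>R x + q *\<^sub>R y \<in> {x. edge_inner E a x \<le> a0}"
    by simp
qed

text \<open>The affine identity mixes coordinates from \<open>E\<close> and \<open>E'\<close>, so it
  needs a point that is truncated to neither edge set. Cut vectors over \<open>UNIV\<close> are such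
  points, and \<open>edge_inner\<close> reads only their values on its own edges.\<close>

lemma edge_inner_cut_vector_UNIV:
  "edge_inner E a (cut_vector UNIV S) = edge_inner E a (cut_vector E S)"
  by (simp add: edge_inner_def cut_vector_def)

text \<open>A convex set, here a half-space, contains a hull as soon as it contains the
  generators.\<close>

lemma valid_inequality_cut_polytope_iff:
  "valid_inequality E a a0 (cut_polytope V E) \<longleftrightarrow>
    (\<forall>S\<subseteq>V. edge_inner E a (cut_vector UNIV S) \<le> a0)"
proof -
  have "valid_inequality E a a0 (cut_polytope V E) \<longleftrightarrow>
      cut_polytope V E \<subseteq> {x. edge_inner E a x \<le> a0}"
    by (auto simp: valid_inequality_def)
  also have "\<dots> \<longleftrightarrow> {cut_vector E S | S. S \<subseteq> V} \<subseteq> {x. edge_inner E a x \<le> a0}"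
    unfolding cut_polytope_def by (simp add: convex_edge_inner_le subset_hull)
  finally show ?thesis
    by (auto simp: edge_inner_cut_vector_UNIV)
qed

lemma cut_vector_UNIV_pair:
  assumes "u \<noteq> v"
  shows "cut_vector UNIV S {u, v} = of_bool ((u \<in> S) \<noteq> (v \<in> S))"
  using assms by (simp add: cut_vector_def Int_insert_right)

text \<open>These are the triangle inequalities: a cut contains either none or exactly two of the
  three edges of a triangle.\<close>

lemma triangular_form_cut_vector_le_0:
  assumes "D \<in> triangular_forms u v w" "u \<noteq> v" "w \<noteq> u" "w \<noteq> v"
  shows "D (cut_vector UNIV S) \<le> 0"
  using assms
  by (auto simp: triangular_forms_def tri_homogeneous_def tri_inhomogeneous_def
      cut_vector_UNIV_pair)

text \<open>The side \<open>b\<close> depends on \<open>S\<close> only through \<open>u\<close> and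
  \<open>v\<close>. Quantifying over \<open>S'\<close> lets one common cut later serve all edges of
  \<open>F\<close>.\<close>

lemma triangular_form_cut_vector_eq_0:
  assumes "D \<in> triangular_forms u v w" "u \<noteq> v" "w \<noteq> u" "w \<noteq> v"
  obtains b where "\<And>S'. u \<in> S' \<longleftrightarrow> u \<in> S \<Longrightarrow> v \<in> S' \<longleftrightarrow> v \<in> S \<Longrightarrow> w \<in> S' \<longleftrightarrow> b \<Longrightarrow>
    D (cut_vector UNIV S') = 0"
proof -
  consider "D = tri_homogeneous u v w" | "D = tri_homogeneous w v u"
    | "D = tri_homogeneous u w v" | "D = tri_inhomogeneous u v w"
    using assms(1) unfolding triangular_forms_def by blast
  \<comment> \<open>With \<open>w\<close> on the side of \<open>u\<close>,
    \<open>x {u, w} = 0\<close> and \<open>x {u, v} = x {v, w}\<close>, which settles the first two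
    forms. The third is symmetric, with \<open>v\<close> in place of \<open>u\<close>. With
    \<open>w\<close> opposite to \<open>u\<close>, exactly two of the three edges are cut, so the
    last form vanishes.\<close>
  then show thesis
  proof cases
    case 1
    show thesis
      by (rule that[of "u \<in> S"])
        (simp add: 1 tri_homogeneous_def cut_vector_UNIV_pair assms(2-4) assms(2-4)[symmetric])
  next
    case 2
    show thesis
      by (rule that[of "u \<in> S"])
        (simp add: 2 tri_homogeneous_def cut_vector_UNIV_pair assms(2-4) assms(2-4)[symmetric])
  next
    case 3
    show thesis
      by (rule that[of "v \<in> S"])
        (simp add: 3 tri_homogeneous_def cut_vector_UNIV_pair assms(2-4) assms(2-4)[symmetric])
  next
    case 4
    show thesis
      by (rule that[of "u \<notin> S"])
        (simp add: 4 tri_inhomogeneous_def cut_vector_UNIV_pair assms(2-4) assms(2-4)[symmetric])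
  qed
qed

theorem theorem3p6:
  fixes V V' :: "'v set" and E E' F :: "'v set set" and w :: "'v set \<Rightarrow> 'v"
    and a a' :: "'v set \<Rightarrow> real" and a0 a0' :: real
  assumes "simple_graph V E"
    and "F \<subseteq> E"
    and "simple_graph V' E'"
    and "triangular_elimination_graph V E F w V' E'"
    and "triangular_elimination_inequality E F w E' a a0 a' a0'"
  shows "valid_inequality E' a' a0' (cut_polytope V' E') \<longleftrightarrow>
         valid_inequality E a a0 (cut_polytope V E)"
proof -
  have V': "V' = V \<union> w ` F" and inj: "inj_on w F" and new: "w ` F \<inter> V = {}"
    using assms(4) by (auto simp: triangular_elimination_graph_def)
  obtain D where D: "\<And>u v. {u, v} \<in> F \<Longrightarrow> D {u, v} \<in> triangular_forms u v (w {u, v})"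
    and eq: "\<And>x. edge_inner E' a' x - a0' = edge_inner E a x - a0 + (\<Sum>e\<in>F. \<bar>a e\<bar> * D e x)"
    using assms(5) unfolding triangular_elimination_inequality_def by blast
  have sub: "e \<subseteq> V" if "e \<in> E" for e
    using that assms(1) by (auto simp: simple_graph_def)
  have restrict: "edge_inner E a (cut_vector UNIV T) = edge_inner E a (cut_vector UNIV S)"
    if "T \<inter> V = S \<inter> V" for S T
  proof -
    have "T \<inter> e = S \<inter> e" if "e \<in> E" for e
      using sub[OF that] \<open>T \<inter> V = S \<inter> V\<close> by blast
    then show ?thesis
      by (simp add: edge_inner_def cut_vector_def)
  qed
  \<comment> \<open>The triangle is nondegenerate: \<open>w e\<close> lies outside \<open>V\<close>,
    the endpoints of \<open>e\<close> inside.\<close>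
  have edge: "\<exists>u v. e = {u, v} \<and> u \<noteq> v \<and> w e \<noteq> u \<and> w e \<noteq> v \<and> D e \<in> triangular_forms u v (w e)"
    if "e \<in> F" for e
  proof -
    have "card e = 2" "e \<subseteq> V"
      using that assms(1,2) by (auto simp: simple_graph_def)
    then obtain u v where uv: "e = {u, v}" "u \<noteq> v"
      by (auto simp: card_2_iff)
    have "w e \<notin> V"
      using new that by blast
    with uv \<open>e \<subseteq> V\<close> D[of u v] that show ?thesis
      by blast
  qed
  show ?thesis
    unfolding valid_inequality_cut_polytope_iff
  proof (intro iffI allI impI)
    fix S
    assume valid: "\<forall>S\<subseteq>V. edge_inner E a (cut_vector UNIV S) \<le> a0" and "S \<subseteq> V'"
    have "D e (cut_vector UNIV S) \<le> 0" if "e \<in> F" for e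
      using edge[OF that] by (elim exE conjE) (rule triangular_form_cut_vector_le_0)
    then have "(\<Sum>e\<in>F. \<bar>a e\<bar> * D e (cut_vector UNIV S)) \<le> 0"
      by (intro sum_nonpos mult_nonneg_nonpos) auto
    \<comment> \<open>\<open>S\<close> may contain new nodes, but \<open>S \<inter> V\<close>
      defines a cut of the old graph with the same values on \<open>E\<close>.\<close>
    moreover have "edge_inner E a (cut_vector UNIV S) \<le> a0"
      using valid restrict[of "S \<inter> V" S] by (metis inf.idem inf_assoc inf_le2)
    ultimately show "edge_inner E' a' (cut_vector UNIV S) \<le> a0'"
      using eq[of "cut_vector UNIV S"] by linarith
  next
    fix S
    assume valid: "\<forall>S\<subseteq>V'. edge_inner E' a' (cut_vector UNIV S) \<le> a0'" and S: "S \<subseteq> V"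
    have "\<exists>b. \<forall>S'. S' \<inter> e = S \<inter> e \<longrightarrow> (w e \<in> S' \<longleftrightarrow> b) \<longrightarrow> D e (cut_vector UNIV S') = 0"
      if eF: "e \<in> F" for e
    proof -
      obtain u v where e: "e = {u, v}" "u \<noteq> v" "w e \<noteq> u" "w e \<noteq> v"
          "D e \<in> triangular_forms u v (w e)"
        using edge[OF eF] by blast
      obtain b where b: "\<And>S'. u \<in> S' \<longleftrightarrow> u \<in> S \<Longrightarrow> v \<in> S' \<longleftrightarrow> v \<in> S \<Longrightarrow> w e \<in> S' \<longleftrightarrow> b \<Longrightarrow>
          D e (cut_vector UNIV S') = 0"
        by (rule triangular_form_cut_vector_eq_0[OF e(5,2-4), where S = S]) (rule that)
      have "u \<in> S' \<longleftrightarrow> u \<in> S" "v \<in> S' \<longleftrightarrow> v \<in> S" if "S' \<inter> e = S \<inter> e" for S'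
        using that unfolding e(1) by blast+
      then have "\<forall>S'. S' \<inter> e = S \<inter> e \<longrightarrow> (w e \<in> S' \<longleftrightarrow> b) \<longrightarrow> D e (cut_vector UNIV S') = 0"
        by (intro allI impI b)
      then show ?thesis ..
    qed
    then obtain b where b: "\<And>e S'. e \<in> F \<Longrightarrow> S' \<inter> e = S \<inter> e \<Longrightarrow> w e \<in> S' \<longleftrightarrow> b e \<Longrightarrow>
        D e (cut_vector UNIV S') = 0"
      by metis
    \<comment> \<open>Only new nodes are added, so the trace on \<open>V\<close>, which determined
      each \<open>b e\<close>, stays unchanged.\<close>
    define T where "T = S \<union> w ` {e \<in> F. b e}"
    have TV: "T \<inter> V = S \<inter> V"
      using new by (auto simp: T_def)
    have "D e (cut_vector UNIV T) = 0" if "e \<in> F" for e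
    proof (rule b[OF that])
      show "T \<inter> e = S \<inter> e"
        using TV sub[of e] that assms(2) by blast
      \<comment> \<open>\<open>w e\<close> is not in \<open>S\<close>, and by injectivity no other
        edge of \<open>F\<close> can bring it into \<open>T\<close>.\<close>
      show "w e \<in> T \<longleftrightarrow> b e"
        using that S new inj by (auto simp: T_def inj_on_def)
    qed
    then have "(\<Sum>e\<in>F. \<bar>a e\<bar> * D e (cut_vector UNIV T)) = 0"
      by simp
    moreover have "T \<subseteq> V'"
      using S by (auto simp: T_def V')
    with valid have "edge_inner E' a' (cut_vector UNIV T) \<le> a0'"
      by blast
    ultimately show "edge_inner E a (cut_vector UNIV S) \<le> a0"
      using eq[of "cut_vector UNIV T"] restrict[OF TV] by linarith
  qed
qed

end
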